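(* Let $C_0,C_1,C_2,\ldots$ be independent and identically distributed complex-valued random variables with absolutely continuous distribution and $\mathbb{E}[|C_0|^t]<\infty$ for some $t>0$, and let $P_n(z)=\sum_{k=0}^nC_kz^k$. If $E$ is a polygon inscribed in $\mathbb{T}$, then the expected number of zeros of $P_n$ in $E$ satisfies $$\mathbb{E}\left[n\,\tau_n(E)\right]=O\left(\sqrt{n\log n}\right)\quad\text{as } n\to\infty.$$
   Context: $\mathbb{T}=\{z\in\mathbb{C}:|z|=1\}$. A polygon inscribed in $\mathbb{T}$ is the closed polygonal region (boundary and interior) all of whose vertices lie on $\mathbb{T}$. "Absolutely continuous" means having a density with respect to area measure on $\mathbb{C}$; in particular $C_0C_n\neq0$ almost surely. $\tau_n=\frac1n\sum_{k=1}^n\delta_{Z_k}$ is the normalized counting measure of the $n$ complex zeros $Z_1,\dots,Z_n$ of $P_n$ (with multiplicity), so $n\tau_n(E)$ is the number of zeros in $E$. The implied constant may depend on $E$ and on the distribution of $C_0$. *)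

theory Defs
  imports
    "HOL-Probability.Probability"
    "HOL-Computational_Algebra.Computational_Algebra"
    "HOL-Library.Landau_Symbols"
begin

fun polyline :: "complex list \<Rightarrow> real \<Rightarrow> complex" where
  "polyline [] = linepath 0 0"
| "polyline [a] = linepath a a"
| "polyline [a, b] = linepath a b"
| "polyline (a # b # c # vs) = linepath a b +++ polyline (b # c # vs)"

definition polygon_boundary :: "complex list \<Rightarrow> complex set" where
  "polygon_boundary vs = path_image (polyline (vs @ [hd vs]))"

(* The vertices are listed once each in cyclic order; the appended copy of the first vertex
   closes the path. Convexity is not required: simplicity of the boundary already
   forces the vertices of an inscribed polygon to be in circular order. *)
definition inscribed_polygon :: "complex set \<Rightarrow> bool" where
  "inscribed_polygon E \<longleftrightarrow>
     (\<exists>vs. length vs \<ge> 3 \<and> set vs \<subseteq> sphere 0 1 \<and> simple_path (polyline (vs @ [hd vs])) \<and>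
           E = polygon_boundary vs \<union> inside (polygon_boundary vs))"

definition random_poly :: "(nat \<Rightarrow> 'a \<Rightarrow> complex) \<Rightarrow> nat \<Rightarrow> 'a \<Rightarrow> complex poly" where
  "random_poly C n \<omega> = (\<Sum>k\<le>n. monom (C k \<omega>) k)"

(* (1/n) times the sum of the Dirac masses at the zeros of p, repeated by multiplicity, evaluated
   at E. The normalization is by n itself; for p = random_poly C n \<omega> this is almost surely the
   degree of p. Note that proots 0 = {#}. *)
definition zero_measure :: "nat \<Rightarrow> complex poly \<Rightarrow> complex set \<Rightarrow> real" where
  "zero_measure n p E = (1 / real n) * (\<Sum>z\<in>#proots p. indicator E z)"

end

theory Submission
  imports Defs "HOL-Complex_Analysis.Conformal_Mappings"
begin

text \<open>
  Near its vertices, and only there, an inscribed polygon reaches the unit circle, and it does so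
  non-tangentially: every \<open>z\<close> in the convex hull of the vertices has a vertex \<open>v\<close> with
  \<open>dist z v \<le> K * (1 - norm z)\<close> (\<open>hull_nontangential\<close>). For any \<open>s > 0\<close> the polygon is therefore
  covered by the disc \<open>norm z \<le> 1 - s\<close> and the balls of radius \<open>K * s\<close> around the vertices.
  In both kinds of regions the zeros are counted by Jensen's method, in the form of a comparison
  with Blaschke factors (\<open>blaschke_bound\<close>). If the coefficients are at most a power of \<open>n\<close> in
  modulus and \<open>norm (poly p w) \<ge> 1 / n\<close> for one fixed point \<open>w\<close> of the open disc, then the smaller
  disc contains \<open>O(ln n / s)\<close> zeros. If \<open>norm (poly p v) \<ge> 1 / n\<close> at a vertex \<open>v\<close>, then the ball
  at \<open>v\<close> contains \<open>O(n * s + ln n)\<close> zeros, because the polynomial grows at most by the factor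
  \<open>exp (2 * K * n * s)\<close> on the ball of twice the radius. The choice \<open>s = sqrt (ln n / n)\<close>
  balances the two bounds at the order \<open>sqrt (n * ln n)\<close>.

  There are never more than \<open>n\<close> zeros, so the exceptional event may be ignored once its
  probability is \<open>O(1 / n)\<close>. For large coefficients this is Markov's inequality and a union bound.
  The other point is that the polynomial is not too small at \<open>w\<close> and at the vertices
  (\<open>random_poly_small_value\<close>). The density of the coefficients may be unbounded, so a
  single coefficient can be so concentrated near \<open>0\<close> that the
  logarithm of its modulus has expectation \<open>-\<infinity>\<close>; therefore the constant coefficient alone, and with it
  the classical choice \<open>w = 0\<close>, does not give the required estimate. But the density is bounded on some set \<open>A\<close>
  of positive probability \<open>a\<close>. The first coefficient that falls into \<open>A\<close> smooths the
  distribution of the whole sum, and no coefficient falls into \<open>A\<close> only with the exponentially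
  small probability \<open>(1 - a) ^ (n + 1)\<close>. The smoothing by the coefficient with index \<open>k\<close> is scaled by
  \<open>norm w ^ k\<close>, which is harmless as long as \<open>1 - a < (norm w)\<^sup>2\<close>, since index \<open>k\<close> is reached only with probability \<open>(1 - a) ^ k\<close>.
\<close>

section \<open>Inscribed polygons approach the circle non-tangentially\<close>

lemma path_image_polyline_subset_hull:
  "vs \<noteq> [] \<Longrightarrow> path_image (polyline vs) \<subseteq> convex hull (set vs)"
proof (induction vs rule: polyline.induct)
  case (4 a b c vs)
  have "path_image (linepath a b) \<subseteq> convex hull (set (a # b # c # vs))"
    by (auto simp: segment_convex_hull intro!: hull_mono del: subsetI)
  moreover have "path_image (polyline (b # c # vs)) \<subseteq> convex hull (set (a # b # c # vs))"
    using 4 by (rule_tac order_trans[OF _ hull_mono[of "set (b # c # vs)"]]) auto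
  ultimately show ?case
    using path_image_join_subset[of "linepath a b" "polyline (b # c # vs)"] by auto
qed (auto simp: segment_convex_hull)

text \<open>
  Everything outside the convex hull of the vertices can be joined to infinity without
  meeting the boundary, so it cannot be inside.
\<close>

lemma inscribed_polygon_subset_hull:
  assumes "inscribed_polygon E"
  obtains V where "finite V" "V \<subseteq> sphere 0 1" "E \<subseteq> convex hull V"
proof -
  obtain vs where vs: "length vs \<ge> 3" "set vs \<subseteq> sphere 0 1"
    and E: "E = polygon_boundary vs \<union> inside (polygon_boundary vs)"
    using assms unfolding inscribed_polygon_def by blast
  have "vs \<noteq> []"
    using vs by auto
  then have "set (vs @ [hd vs]) = set vs"
    by auto
  then have b: "polygon_boundary vs \<subseteq> convex hull (set vs)"
    using path_image_polyline_subset_hull[of "vs @ [hd vs]"]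
    by (simp add: polygon_boundary_def)
  have "inside (polygon_boundary vs) \<subseteq> convex hull (set vs)"
    using outside_subset_convex[OF convex_convex_hull b] by (auto simp: inside_outside)
  with b vs E show ?thesis
    by (intro that[of "set vs"]) auto
qed

lemma finite_separation:
  fixes V :: "'a::metric_space set"
  assumes "finite V"
  obtains d where "d > 0" "\<And>x y. x \<in> V \<Longrightarrow> y \<in> V \<Longrightarrow> x \<noteq> y \<Longrightarrow> d \<le> dist x y"
proof -
  \<comment> \<open>The element \<open>1\<close> keeps \<open>D\<close> nonempty when \<open>V\<close> has at most one point.\<close>
  define D where "D = insert 1 ((\<lambda>(x, y). dist x y) ` ((V \<times> V) - Id))"
  have D: "finite D" "D \<noteq> {}" "\<And>x. x \<in> D \<Longrightarrow> x > 0"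
    using assms by (auto simp: D_def)
  show ?thesis
  proof (rule that[of "Min D"])
    show "Min D > 0" using D by simp
    show "Min D \<le> dist x y" if "x \<in> V" "y \<in> V" "x \<noteq> y" for x y
      using D that by (intro Min_le) (force simp: D_def)+
  qed
qed

text \<open>
  Read the coefficients \<open>u\<close> of a convex combination \<open>z\<close> as probabilities of the points of \<open>V\<close>.
  As these points lie on the unit sphere, \<open>1 - (norm z)\<^sup>2\<close> is the variance
  \<open>\<Sum>x\<in>V. u x * (dist z x)\<^sup>2\<close>. Let \<open>v\<close> be a nearest point of \<open>V\<close>. All other points are at
  distance at least half the minimal separation \<open>d\<close>, so the variance is at least
  \<open>(d/2)\<^sup>2 * (1 - u v)\<close>, whereas \<open>dist z v\<close> is at most \<open>2 * (1 - u v)\<close>.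
\<close>

lemma hull_nontangential:
  fixes V :: "'a::real_inner set"
  assumes V: "finite V" "V \<subseteq> sphere 0 1"
  obtains K where "K > 0"
    "\<And>z. z \<in> convex hull V \<Longrightarrow> \<exists>v\<in>V. dist z v \<le> K * (1 - norm z)"
proof -
  obtain d where d: "d > 0" "\<And>x y. x \<in> V \<Longrightarrow> y \<in> V \<Longrightarrow> x \<noteq> y \<Longrightarrow> d \<le> dist x y"
    using finite_separation[OF V(1)] by blast
  have unit: "norm v = 1" if "v \<in> V" for v
    using V that by auto
  show ?thesis
  proof (rule that[of "16 / d\<^sup>2"])
    show "16 / d\<^sup>2 > 0" using d by simp
    fix z assume z: "z \<in> convex hull V"
    then obtain u where u: "\<And>v. v \<in> V \<Longrightarrow> 0 \<le> u v" "sum u V = 1" and uz: "(\<Sum>v\<in>V. u v *\<^sub>R v) = z"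
      unfolding convex_hull_finite[OF V(1)] by blast
    have "V \<noteq> {}" using z by auto
    then obtain v where v: "v \<in> V" "\<And>x. x \<in> V \<Longrightarrow> dist z v \<le> dist z x"
      using ex_is_arg_min_if_finite[of V "dist z"] V(1)
      by (auto simp: is_arg_min_linorder)
    have split: "sum f V = f v + sum f (V - {v})" for f :: "'a \<Rightarrow> real"
      using v V by (simp add: sum.remove)
    have rest: "sum u (V - {v}) = 1 - u v"
      using split[of u] u by simp
    have far: "(d / 2)\<^sup>2 \<le> (dist z x)\<^sup>2" if "x \<in> V - {v}" for x
    proof (intro power_mono)
      have "d \<le> dist x v" using that v d by auto
      also have "\<dots> \<le> dist z x + dist z v" using dist_triangle2[of x v z] by (simp add: dist_commute)
      also have "\<dots> \<le> 2 * dist z x" using v that by auto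
      finally show "d / 2 \<le> dist z x" by simp
    qed (use d in auto)
    have "(\<Sum>x\<in>V. u x * (dist z x)\<^sup>2) = (\<Sum>x\<in>V. u x - 2 * ((u x *\<^sub>R x) \<bullet> z) + u x * (norm z)\<^sup>2)"
    proof (intro sum.cong refl)
      fix x assume x: "x \<in> V"
      have "x \<bullet> x = 1" using unit[OF x] by (simp add: norm_eq_sqrt_inner)
      then have "(dist z x)\<^sup>2 = 1 - 2 * (x \<bullet> z) + (norm z)\<^sup>2"
        by (simp add: dist_norm power2_norm_eq_inner inner_diff inner_commute)
      then show "u x * (dist z x)\<^sup>2 = u x - 2 * ((u x *\<^sub>R x) \<bullet> z) + u x * (norm z)\<^sup>2"
        by (simp only: inner_scaleR_left) (simp add: algebra_simps)
    qed
    also have "\<dots> = sum u V - 2 * ((\<Sum>x\<in>V. u x *\<^sub>R x) \<bullet> z) + sum u V * (norm z)\<^sup>2"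
      by (simp add: sum.distrib sum_subtractf inner_sum_left sum_distrib_left sum_distrib_right)
    also have "\<dots> = 1 - (norm z)\<^sup>2"
      by (simp add: u uz power2_norm_eq_inner)
    finally have var: "(\<Sum>x\<in>V. u x * (dist z x)\<^sup>2) = 1 - (norm z)\<^sup>2" .
    have "(d/2)\<^sup>2 * (1 - u v) = (\<Sum>x\<in>V - {v}. u x * (d/2)\<^sup>2)"
      by (simp add: sum_distrib_right[symmetric] rest mult.commute)
    also have "\<dots> \<le> (\<Sum>x\<in>V - {v}. u x * (dist z x)\<^sup>2)"
      using far u by (intro sum_mono mult_left_mono) auto
    also have "\<dots> \<le> (\<Sum>x\<in>V. u x * (dist z x)\<^sup>2)"
      unfolding split[of "\<lambda>x. u x * (dist z x)\<^sup>2"] using u v by simp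
    finally have lower: "(d/2)\<^sup>2 * (1 - u v) \<le> 1 - (norm z)\<^sup>2" using var by simp
    have zv: "z - v = (\<Sum>x\<in>V - {v}. u x *\<^sub>R (x - v))"
    proof -
      have "(\<Sum>x\<in>V - {v}. u x *\<^sub>R (x - v)) = (\<Sum>x\<in>V. u x *\<^sub>R (x - v))"
        using v V by (simp add: sum.remove)
      also have "\<dots> = z - v"
        by (simp add: scaleR_diff_right sum_subtractf uz scaleR_sum_left[symmetric] u)
      finally show ?thesis by simp
    qed
    have "dist z v \<le> (\<Sum>x\<in>V - {v}. u x * 2)"
      unfolding dist_norm zv
    proof (intro sum_norm_le)
      fix x assume x: "x \<in> V - {v}"
      have "norm (x - v) \<le> 2"
        using norm_triangle_ineq4[of x v] unit[of x] unit[of v] x v by simp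
      then show "norm (u x *\<^sub>R (x - v)) \<le> u x * 2"
        using u x by (simp add: mult_left_mono)
    qed
    then have upper: "dist z v \<le> 2 * (1 - u v)"
      by (simp add: sum_distrib_right[symmetric] rest)
    have "1 - (norm z)\<^sup>2 \<le> 2 * (1 - norm z)"
      using zero_le_power2[of "1 - norm z"] by (simp add: power2_eq_square algebra_simps)
    then have "(d/2)\<^sup>2 * (1 - u v) \<le> 2 * (1 - norm z)"
      using lower by linarith
    then have "1 - u v \<le> 8 / d\<^sup>2 * (1 - norm z)"
      using d by (simp add: field_simps power2_eq_square)
    then have "dist z v \<le> 2 * (8 / d\<^sup>2 * (1 - norm z))"
      by (intro order_trans[OF upper] mult_left_mono) auto
    then show "\<exists>v\<in>V. dist z v \<le> 16 / d\<^sup>2 * (1 - norm z)"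
      using v by (intro bexI[of _ v]) auto
  qed
qed

section \<open>Counting the zeros of a polynomial\<close>

text \<open>
  The factor \<open>z - a\<close> and the linear polynomial \<open>(R\<^sup>2 - cnj (a - c) * (z - c)) / R\<close> have the same
  modulus on the circle of radius \<open>R\<close> around \<open>c\<close>; their quotient is the Blaschke factor of \<open>a\<close>.
  Exchanging one for the other keeps the bound \<open>B\<close> on the circle and gains the factor \<open>q\<close> at \<open>w\<close>.
  Once all factors are exchanged, the maximum modulus principle applies. The cofactor \<open>Q\<close> is
  arbitrary because it absorbs the exchanged factors in the induction.
\<close>

lemma blaschke_bound_aux:
  fixes Q :: "complex poly"
  assumes R: "R > 0" and w: "w \<in> cball c R" and q: "q \<ge> 0"
    and A: "\<And>a. a \<in># A \<Longrightarrow> R * dist w a \<le> q * norm (of_real (R\<^sup>2) - cnj (a - c) * (w - c))"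
    and B: "\<And>z. z \<in> sphere c R \<Longrightarrow> norm (poly ((\<Prod>a\<in>#A. [:-a, 1:]) * Q) z) \<le> B"
  shows "norm (poly ((\<Prod>a\<in>#A. [:-a, 1:]) * Q) w) \<le> q ^ size A * B"
  using A B
proof (induction A arbitrary: Q)
  case empty
  have "norm (poly Q w) \<le> B"
  proof (rule maximum_modulus_frontier[of "poly Q" "cball c R"])
    show "norm (poly Q z) \<le> B" if "z \<in> frontier (cball c R)" for z
      using empty(2)[of z] that R by (simp add: sphere_def)
  qed (use w R in \<open>auto intro!: holomorphic_intros continuous_intros\<close>)
  then show ?case by simp
next
  case (add a A)
  let ?b = "smult (1 / of_real R) [:of_real (R\<^sup>2) + cnj (a - c) * c, - cnj (a - c):]"
  let ?P = "\<Prod>a\<in>#A. [:-a, 1:]"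
  have b: "poly ?b z = (of_real (R\<^sup>2) - cnj (a - c) * (z - c)) / of_real R" for z
    by (simp add: algebra_simps diff_divide_distrib add_divide_distrib)
  have sphere: "norm (poly ?b z) = norm (z - a)" if "z \<in> sphere c R" for z
  proof -
    have nz: "norm (z - c) = R" using that by (simp add: dist_norm norm_minus_commute)
    have "complex_of_real (R\<^sup>2) = (z - c) * cnj (z - c)"
      using nz complex_norm_square[of "z - c"] by simp
    then have "of_real (R\<^sup>2) - cnj (a - c) * (z - c) = (z - c) * cnj (z - a)"
      by (simp add: algebra_simps)
    then show ?thesis
      using nz R unfolding b by (simp add: norm_mult norm_divide del: complex_cnj_diff)
  qed
  have repl: "norm (poly (?P * (?b * Q)) z) = norm (poly ?b z) * norm (poly (?P * Q) z)" for z
    by (simp only: poly_mult norm_mult mult_ac)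
  have fact: "norm (poly ((\<Prod>a\<in>#add_mset a A. [:-a, 1:]) * Q) z) = norm (z - a) * norm (poly (?P * Q) z)" for z
  proof -
    have "poly [:-a, 1:] z = z - a" by simp
    then show ?thesis
      by (simp only: image_mset_add_mset prod_mset.add_mset mult.assoc poly_mult norm_mult)
  qed
  have IH: "norm (poly (?P * (?b * Q)) w) \<le> q ^ size A * B"
  proof (rule add.IH)
    show "norm (poly (?P * (?b * Q)) z) \<le> B" if "z \<in> sphere c R" for z
      using add.prems(2)[OF that] unfolding repl fact sphere[OF that] .
  qed (use add.prems in auto)
  have "norm (w - a) \<le> q * norm (poly ?b w)"
    unfolding b using add.prems(1)[of a] R
    by (simp add: norm_divide dist_norm pos_le_divide_eq mult.commute)
  then have "norm (w - a) * norm (poly (?P * Q) w) \<le> q * norm (poly ?b w) * norm (poly (?P * Q) w)"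
    by (intro mult_right_mono) auto
  also have "\<dots> \<le> q * (q ^ size A * B)"
    using IH q unfolding repl mult.assoc by (intro mult_left_mono)
  finally show ?case
    unfolding fact by simp
qed

text \<open>
  The form used below: each zero in \<open>A\<close>, counted with multiplicity, whose Blaschke factor is at
  most \<open>q\<close> at \<open>w\<close> forces the polynomial to be smaller at \<open>w\<close> by the factor \<open>q\<close>. Solved for
  \<open>size A\<close>, this is a version of Jensen's inequality.
\<close>

lemma blaschke_bound:
  fixes p :: "complex poly"
  assumes R: "R > 0" and w: "w \<in> cball c R" and q: "q \<ge> 0" and sub: "A \<subseteq># proots p"
    and A: "\<And>a. a \<in># A \<Longrightarrow> R * dist w a \<le> q * norm (of_real (R\<^sup>2) - cnj (a - c) * (w - c))"
    and B: "\<And>z. z \<in> sphere c R \<Longrightarrow> norm (poly p z) \<le> B"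
  shows "norm (poly p w) \<le> q ^ size A * B"
proof -
  obtain A' where A': "proots p = A + A'"
    using sub by (auto simp: mset_subset_eq_exists_conv)
  have "p = (\<Prod>a\<in>#A. [:-a, 1:]) * smult (lead_coeff p) (\<Prod>a\<in>#A'. [:-a, 1:])"
    using complex_poly_decompose_multiset[of p] by (simp add: A')
  then show ?thesis
    using blaschke_bound_aux[OF R w q A, of A "smult (lead_coeff p) (\<Prod>a\<in>#A'. [:-a, 1:])" B] B
    by metis
qed

lemma pow_bound_ln:
  fixes q y B :: real
  assumes "q > 0" "y > 0" "y \<le> q ^ m * B"
  shows "real m * (- ln q) \<le> ln (B / y)"
proof -
  have "B > 0"
    using assms by (meson less_le_trans zero_less_mult_pos zero_less_power)
  then have "ln y \<le> real m * ln q + ln B"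
    using assms ln_le_cancel_iff[of y "q ^ m * B"] by (simp add: ln_mult ln_realpow)
  then show ?thesis using assms \<open>B > 0\<close> by (simp add: ln_div)
qed

text \<open>
  In the disc of radius \<open>2 * \<delta>\<close> around \<open>v\<close>, the Blaschke factor of a point \<open>a\<close> takes at the
  centre the modulus \<open>dist v a / (2 * \<delta>)\<close>, which is at most \<open>1/2\<close> for the zeros in question.
\<close>

lemma zeros_near_center:
  fixes p :: "complex poly"
  assumes "\<delta> > 0" and "poly p v \<noteq> 0" and "\<And>z. z \<in> sphere v (2 * \<delta>) \<Longrightarrow> norm (poly p z) \<le> B"
  shows "real (size (filter_mset (\<lambda>z. dist z v \<le> \<delta>) (proots p))) * ln 2 \<le> ln (B / norm (poly p v))"
proof -
  let ?A = "filter_mset (\<lambda>z. dist z v \<le> \<delta>) (proots p)"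
  have "norm (poly p v) \<le> (1/2) ^ size ?A * B"
  proof (rule blaschke_bound[where R = "2 * \<delta>" and c = v])
    show "2 * \<delta> * dist v a \<le> 1 / 2 * norm (complex_of_real ((2 * \<delta>)\<^sup>2) - cnj (a - v) * (v - v))"
      if "a \<in># ?A" for a
      using that assms by (simp add: dist_commute power2_eq_square norm_mult)
  qed (use assms in auto)
  then show ?thesis
    using pow_bound_ln[of "1/2" "norm (poly p v)" "size ?A" B] assms by (simp add: ln_div)
qed

lemma pseudohyperbolic_identity:
  "(cmod (1 - cnj a * w))\<^sup>2 - (cmod (w - a))\<^sup>2 = (1 - (cmod a)\<^sup>2) * (1 - (cmod w)\<^sup>2)"
  unfolding cmod_power2 by (simp add: power2_eq_square algebra_simps)

text \<open>
  The square of the Blaschke factor of \<open>a\<close> at \<open>w\<close> differs from \<open>1\<close> by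
  \<open>(1 - (norm a)\<^sup>2) * (1 - (norm w)\<^sup>2) / (norm (1 - cnj a * w))\<^sup>2\<close>, where the denominator is at
  most \<open>4\<close>. For \<open>norm a \<le> 1 - s\<close> this is at least \<open>x = (1 - (norm w)\<^sup>2) * s / 4\<close>, and so every
  such zero costs a factor \<open>exp (- x / 2)\<close>. The reference point \<open>w\<close> is kept general because the
  polynomial may be too small at the centre with a probability that is not negligible.
\<close>

lemma zeros_in_smaller_disc:
  fixes p :: "complex poly"
  assumes s: "0 < s" "s \<le> 1" and w: "norm w < 1" "poly p w \<noteq> 0"
    and B: "\<And>z. z \<in> sphere 0 1 \<Longrightarrow> norm (poly p z) \<le> B"
  shows "real (size (filter_mset (\<lambda>z. norm z \<le> 1 - s) (proots p))) * ((1 - (norm w)\<^sup>2) * s / 8)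
    \<le> ln (B / norm (poly p w))"
proof -
  let ?A = "filter_mset (\<lambda>z. norm z \<le> 1 - s) (proots p)"
  define x where "x = (1 - (norm w)\<^sup>2) * s / 4"
  have w2: "(norm w)\<^sup>2 < 1" using w by (simp add: power_less_one_iff)
  have x: "x > 0" using w2 s by (simp add: x_def)
  have "norm (poly p w) \<le> exp (- x / 2) ^ size ?A * B"
  proof (rule blaschke_bound[where R = 1 and c = 0])
    fix a assume "a \<in># ?A"
    then have a: "norm a \<le> 1 - s" by simp
    have "(norm a)\<^sup>2 \<le> norm a" using a s by (simp add: power2_eq_square mult_left_le)
    then have "s \<le> 1 - (norm a)\<^sup>2" using a by linarith
    then have "4 * x \<le> (1 - (norm a)\<^sup>2) * (1 - (norm w)\<^sup>2)"
      unfolding x_def using w2 by (simp add: mult.commute mult_left_mono)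
    moreover have "(norm (1 - cnj a * w))\<^sup>2 \<le> 2\<^sup>2"
    proof (intro power_mono)
      have "norm a * norm w \<le> 1" using a w s by (intro mult_le_one) auto
      then show "norm (1 - cnj a * w) \<le> 2"
        using norm_triangle_ineq4[of 1 "cnj a * w"] by (simp add: norm_mult)
    qed auto
    then have "x * (norm (1 - cnj a * w))\<^sup>2 \<le> x * 4" using x by (intro mult_left_mono) auto
    ultimately have "(norm (w - a))\<^sup>2 \<le> (1 - x) * (norm (1 - cnj a * w))\<^sup>2"
      using pseudohyperbolic_identity[of a w] by (simp add: algebra_simps)
    also have "\<dots> \<le> exp (- x) * (norm (1 - cnj a * w))\<^sup>2"
      using exp_ge_add_one_self[of "-x"] by (intro mult_right_mono) auto
    also have "\<dots> = (exp (- x / 2) * norm (1 - cnj a * w))\<^sup>2"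
      by (simp add: power_mult_distrib exp_double[symmetric])
    finally have "norm (w - a) \<le> exp (- x / 2) * norm (1 - cnj a * w)"
      by (rule power2_le_imp_le) auto
    then show "1 * dist w a \<le> exp (- x / 2) * norm (complex_of_real (1\<^sup>2) - cnj (a - 0) * (w - 0))"
      by (simp add: dist_norm)
  qed (use w B in auto)
  then show ?thesis
    using pow_bound_ln[of "exp (-x/2)" "norm (poly p w)" "size ?A" B] w
    by (simp add: x_def)
qed

lemma poly_bound_near_disc:
  fixes p :: "complex poly"
  assumes "degree p \<le> n" "\<And>k. k \<le> n \<Longrightarrow> norm (coeff p k) \<le> H" "norm z \<le> 1 + x" "x \<ge> 0"
  shows "norm (poly p z) \<le> real (n + 1) * H * exp (real n * x)"
proof -
  have H: "H \<ge> 0" using assms(2)[of 0] norm_ge_zero[of "coeff p 0"] by linarith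
  have "poly p z = (\<Sum>k\<le>n. coeff p k * z ^ k)"
    unfolding poly_altdef using assms(1)
    by (intro sum.mono_neutral_left) (auto simp: coeff_eq_0)
  also have "norm \<dots> \<le> (\<Sum>k\<le>n. H * exp (real n * x))"
  proof (intro sum_norm_le)
    fix k assume k: "k \<in> {..n}"
    have "norm z ^ k \<le> (1 + x) ^ k" using assms by (intro power_mono) auto
    also have "\<dots> \<le> (1 + x) ^ n" using k assms by (intro power_increasing) auto
    also have "\<dots> \<le> exp x ^ n" using assms by (intro power_mono) auto
    also have "\<dots> = exp (real n * x)" by (simp add: exp_of_nat_mult)
    finally show "norm (coeff p k * z ^ k) \<le> H * exp (real n * x)"
      using assms(2)[of k] k H unfolding norm_mult norm_power by (intro mult_mono) auto
  qed
  finally show ?thesis by simp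
qed

lemma size_filter_le_sum:
  assumes "finite V" "\<And>z. z \<in># A \<Longrightarrow> P z \<Longrightarrow> Q z \<or> (\<exists>v\<in>V. S v z)"
  shows "size (filter_mset P A) \<le> size (filter_mset Q A) + (\<Sum>v\<in>V. size (filter_mset (S v) A))"
  using assms(2)
proof (induction A)
  case (add x A)
  have 1: "(\<Sum>v\<in>V. size (filter_mset (S v) (add_mset x A))) =
    card {v\<in>V. S v x} + (\<Sum>v\<in>V. size (filter_mset (S v) A))"
  proof -
    have "(\<Sum>v\<in>V. size (filter_mset (S v) (add_mset x A))) =
       (\<Sum>v\<in>V. (if S v x then 1 else 0) + size (filter_mset (S v) A))"
      by (intro sum.cong) auto
    also have "\<dots> = card {v\<in>V. S v x} + (\<Sum>v\<in>V. size (filter_mset (S v) A))"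
      using assms(1) by (simp add: sum.distrib sum.If_cases Int_def)
    finally show ?thesis .
  qed
  have "card {v\<in>V. S v x} \<ge> 1" if "P x" "\<not> Q x"
  proof -
    have "{v\<in>V. S v x} \<noteq> {}" using add.prems[of x] that by auto
    then show ?thesis using assms(1) by (simp add: Suc_le_eq card_gt_0_iff)
  qed
  moreover have "size (filter_mset P A) \<le> size (filter_mset Q A) + (\<Sum>v\<in>V. size (filter_mset (S v) A))"
    using add by auto
  ultimately show ?case unfolding 1 by force
qed auto

text \<open>
  A zero of \<open>E\<close> with \<open>norm z > 1 - s\<close> lies within \<open>K * s\<close> of a point of \<open>V\<close>. The zeros in the
  smaller disc are counted from \<open>w\<close> and those near \<open>v\<close> from \<open>v\<close> itself. The term
  \<open>2 * K * s * n\<close> is the logarithm of the possible growth of the polynomial outside the unit disc.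
\<close>

lemma zeros_in_nontangential_set:
  fixes p :: "complex poly"
  assumes deg: "degree p \<le> n" and coeffs: "\<And>k. k \<le> n \<Longrightarrow> norm (coeff p k) \<le> H"
    and V: "finite V" "V \<subseteq> sphere 0 1" and K: "K > 0"
    and E: "\<And>z. z \<in> E \<Longrightarrow> \<exists>v\<in>V. dist z v \<le> K * (1 - norm z)"
    and s: "0 < s" "s \<le> 1" and w: "norm w < 1" and h: "h > 0"
    and pw: "norm (poly p w) \<ge> h" and pV: "\<And>v. v \<in> V \<Longrightarrow> norm (poly p v) \<ge> h"
  shows "real (size (filter_mset (\<lambda>z. z \<in> E) (proots p)))
    \<le> 8 / ((1 - (norm w)\<^sup>2) * s) * ln (real (n + 1) * H / h)
      + real (card V) / ln 2 * (2 * K * s * real n + ln (real (n + 1) * H / h))"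
proof -
  let ?N = "\<lambda>P. real (size (filter_mset P (proots p)))"
  let ?B = "real (n + 1) * H"
  have B1: "norm (poly p z) \<le> ?B" if "norm z \<le> 1" for z
    using poly_bound_near_disc[OF deg coeffs, of z 0] that by simp
  have Bpos: "?B > 0" using B1[of w] pw h w by auto
  have "(norm w)\<^sup>2 < 1" using w by (simp add: power_less_one_iff)
  then have pos: "(1 - (norm w)\<^sup>2) * s > 0" using s by simp
  have "?N (\<lambda>z. norm z \<le> 1 - s) * ((1 - (norm w)\<^sup>2) * s / 8) \<le> ln (?B / norm (poly p w))"
    using pw h s w B1 by (intro zeros_in_smaller_disc) auto
  also have "\<dots> \<le> ln (?B / h)"
  proof -
    have "?B / norm (poly p w) \<le> ?B / h"
      using pw h Bpos by (intro divide_left_mono mult_pos_pos) linarith+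
    moreover have "?B / norm (poly p w) > 0" using pw h Bpos by (intro divide_pos_pos) linarith+
    ultimately show ?thesis by (simp only: ln_mono)
  qed
  finally have far: "?N (\<lambda>z. norm z \<le> 1 - s) \<le> 8 / ((1 - (norm w)\<^sup>2) * s) * ln (?B / h)"
    using pos by (simp add: field_simps)
  have near: "?N (\<lambda>z. dist z v \<le> K * s) \<le> 1 / ln 2 * (2 * K * s * real n + ln (?B / h))"
    if v: "v \<in> V" for v
  proof -
    let ?B' = "?B * exp (real n * (2 * (K * s)))"
    have "?N (\<lambda>z. dist z v \<le> K * s) * ln 2 \<le> ln (?B' / norm (poly p v))"
    proof (rule zeros_near_center)
      show "poly p v \<noteq> 0" using pV[OF v] h by auto
      show "norm (poly p z) \<le> ?B'" if "z \<in> sphere v (2 * (K * s))" for z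
      proof (rule poly_bound_near_disc[OF deg coeffs])
        have "norm v = 1" using v V by auto
        then show "norm z \<le> 1 + 2 * (K * s)"
          using norm_triangle_ineq[of v "z - v"] that by (simp add: dist_norm norm_minus_commute)
      qed (use K s in auto)
    qed (use K s in auto)
    also have "\<dots> \<le> ln (?B' / h)"
    proof -
      have B': "?B' > 0" using Bpos by (rule mult_pos_pos) (rule exp_gt_zero)
      have "?B' / norm (poly p v) \<le> ?B' / h"
        using pV[OF v] h B' by (intro divide_left_mono mult_pos_pos) linarith+
      moreover have "?B' / norm (poly p v) > 0"
        using pV[OF v] h B' by (intro divide_pos_pos) linarith+
      ultimately show ?thesis by (simp only: ln_mono)
    qed
    also have "?B' / h = exp (real n * (2 * (K * s))) * (?B / h)" by simp
    also have "ln \<dots> = real n * (2 * (K * s)) + ln (?B / h)"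
      using Bpos h by (subst ln_mult) auto
    finally show ?thesis by (simp add: field_simps)
  qed
  have "?N (\<lambda>z. z \<in> E) \<le> ?N (\<lambda>z. norm z \<le> 1 - s) + (\<Sum>v\<in>V. ?N (\<lambda>z. dist z v \<le> K * s))"
  proof -
    have "size (filter_mset (\<lambda>z. z \<in> E) (proots p)) \<le> size (filter_mset (\<lambda>z. norm z \<le> 1 - s) (proots p))
      + (\<Sum>v\<in>V. size (filter_mset (\<lambda>z. dist z v \<le> K * s) (proots p)))"
    proof (rule size_filter_le_sum[OF V(1)])
      fix z assume "z \<in> E"
      then obtain v where v: "v \<in> V" "dist z v \<le> K * (1 - norm z)" using E by blast
      show "norm z \<le> 1 - s \<or> (\<exists>v\<in>V. dist z v \<le> K * s)"
      proof (cases "norm z \<le> 1 - s")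
        case False
        then have "K * (1 - norm z) \<le> K * s" using K by (intro mult_left_mono) auto
        with v show ?thesis by force
      qed simp
    qed
    then show ?thesis
      by (metis (mono_tags, lifting) of_nat_add of_nat_mono of_nat_sum sum.cong)
  qed
  also have "(\<Sum>v\<in>V. ?N (\<lambda>z. dist z v \<le> K * s)) \<le>
     (\<Sum>v\<in>V. 1 / ln 2 * (2 * K * s * real n + ln (?B / h)))"
    by (intro sum_mono near)
  finally show ?thesis using far by simp
qed

section \<open>Small values of random sums\<close>

text \<open>
  One step of the smoothing argument for \<open>b * x + y\<close> with independent \<open>x\<close> and \<open>y\<close>.
  If \<open>x\<close> falls into \<open>A\<close>, its own distribution makes the small ball unlikely, whatever \<open>y\<close> is;
  otherwise the distribution of \<open>y\<close> does so. By Fubini's theorem the integration runs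
  first over \<open>x\<close> in the former case and first over \<open>y\<close> in the latter.
\<close>

lemma emeasure_pair_small_ball:
  fixes \<mu> \<nu> :: "complex measure"
  assumes "prob_space \<mu>" "prob_space \<nu>"
    and sets: "sets \<mu> = sets borel" "sets \<nu> = sets borel" and A: "A \<in> sets borel"
    and small1: "\<And>c. emeasure \<mu> (A \<inter> {x. norm (b * x + c) < \<epsilon>}) \<le> e1"
    and small2: "\<And>c. emeasure \<nu> {y. norm (y + c) < \<epsilon>} \<le> e2"
  shows "emeasure (\<mu> \<Otimes>\<^sub>M \<nu>) {z. norm (b * fst z + snd z + c) < \<epsilon>} \<le> e1 + emeasure \<mu> (- A) * e2"
proof -
  interpret \<mu>: prob_space \<mu> by fact
  interpret \<nu>: prob_space \<nu> by fact
  interpret P: pair_sigma_finite \<mu> \<nu> ..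
  let ?H = "{z. norm (b * fst z + snd z + c) < \<epsilon>}"
  have sp: "sets (\<mu> \<Otimes>\<^sub>M \<nu>) = sets (borel \<Otimes>\<^sub>M borel)"
    using sets by (intro sets_pair_measure_cong) auto
  have H: "?H \<in> sets (borel :: (complex \<times> complex) measure)"
    by (intro borel_open open_Collect_less continuous_intros)
  have meas: "?H \<inter> B \<times> UNIV \<in> sets (\<mu> \<Otimes>\<^sub>M \<nu>)" if "B \<in> sets borel" for B
    unfolding sp using H that by (intro sets.Int pair_measureI) (simp_all only: borel_prod, simp_all)
  have "emeasure (\<mu> \<Otimes>\<^sub>M \<nu>) (?H \<inter> A \<times> UNIV) \<le> (\<integral>\<^sup>+y. e1 \<partial>\<nu>)"
    unfolding P.emeasure_pair_measure_alt2[OF meas[OF A]]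
  proof (intro nn_integral_mono)
    fix y
    have "(\<lambda>x. (x, y)) -` (?H \<inter> A \<times> UNIV) = A \<inter> {x. norm (b * x + (y + c)) < \<epsilon>}"
      by (auto simp: add.assoc)
    then show "emeasure \<mu> ((\<lambda>x. (x, y)) -` (?H \<inter> A \<times> UNIV)) \<le> e1"
      using small1 by simp
  qed
  then have 1: "emeasure (\<mu> \<Otimes>\<^sub>M \<nu>) (?H \<inter> A \<times> UNIV) \<le> e1"
    by (simp add: \<nu>.emeasure_space_1)
  have A': "- A \<in> sets borel" using A by auto
  have "emeasure (\<mu> \<Otimes>\<^sub>M \<nu>) (?H \<inter> (- A) \<times> UNIV) \<le> (\<integral>\<^sup>+x. e2 * indicator (- A) x \<partial>\<mu>)"
    unfolding \<nu>.emeasure_pair_measure_alt[OF meas[OF A']]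
  proof (intro nn_integral_mono)
    fix x
    have "Pair x -` (?H \<inter> (- A) \<times> UNIV) = (if x \<in> A then {} else {y. norm (y + (b * x + c)) < \<epsilon>})"
      by (auto simp: algebra_simps)
    then show "emeasure \<nu> (Pair x -` (?H \<inter> (- A) \<times> UNIV)) \<le> e2 * indicator (- A) x"
      using small2[of "b * x + c"] by auto
  qed
  then have 2: "emeasure (\<mu> \<Otimes>\<^sub>M \<nu>) (?H \<inter> (- A) \<times> UNIV) \<le> emeasure \<mu> (- A) * e2"
    using A' sets by (simp add: nn_integral_cmult_indicator mult.commute)
  have "?H = (?H \<inter> A \<times> UNIV) \<union> (?H \<inter> (- A) \<times> UNIV)" by auto
  then have "emeasure (\<mu> \<Otimes>\<^sub>M \<nu>) ?H \<le>
      emeasure (\<mu> \<Otimes>\<^sub>M \<nu>) (?H \<inter> A \<times> UNIV) + emeasure (\<mu> \<Otimes>\<^sub>M \<nu>) (?H \<inter> (- A) \<times> UNIV)"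
    using emeasure_subadditive[OF meas[OF A] meas[OF A']] by simp
  also have "\<dots> \<le> e1 + emeasure \<mu> (- A) * e2"
    using 1 2 by (rule add_mono)
  finally show ?thesis .
qed

lemma (in prob_space) indep_var_power_sum:
  fixes C :: "nat \<Rightarrow> 'a \<Rightarrow> complex"
  assumes "indep_vars (\<lambda>_. borel) C UNIV" "k \<notin> J" "finite J"
  shows "indep_var borel (C k) borel (\<lambda>\<omega>. \<Sum>j\<in>J. C j \<omega> * w ^ j)"
proof -
  have "indep_var borel ((\<lambda>f. f k) \<circ> (\<lambda>\<omega>. restrict (\<lambda>i. C i \<omega>) {k}))
      borel ((\<lambda>f. \<Sum>j\<in>J. f j * w ^ j) \<circ> (\<lambda>\<omega>. restrict (\<lambda>i. C i \<omega>) J))"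
    using assms by (intro indep_var_compose[OF indep_var_restrict[OF assms(1)]]) auto
  also have "((\<lambda>f. f k) \<circ> (\<lambda>\<omega>. restrict (\<lambda>i. C i \<omega>) {k})) = C k"
    by auto
  also have "((\<lambda>f. \<Sum>j\<in>J. f j * w ^ j) \<circ> (\<lambda>\<omega>. restrict (\<lambda>i. C i \<omega>) J)) = (\<lambda>\<omega>. \<Sum>j\<in>J. C j \<omega> * w ^ j)"
    by (auto cong: rev_conj_cong)
  finally show ?thesis .
qed

text \<open>
  A density is finite almost everywhere, so one of its sublevel sets has positive probability.
\<close>

lemma bounded_density_part:
  assumes "prob_space M" "distributed M lborel X (f :: complex \<Rightarrow> ennreal)"
  obtains A D where "A \<in> sets borel" "measure (distr M borel X) A > 0" "D \<ge> 0"
    "\<And>c r. r \<ge> 0 \<Longrightarrow> emeasure (distr M borel X) (A \<inter> ball c r) \<le> ennreal (D * r\<^sup>2)"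
proof -
  let ?\<mu> = "distr M borel X"
  have f: "f \<in> borel_measurable borel" and X: "X \<in> M \<rightarrow>\<^sub>M borel"
    using distributed_borel_measurable[OF assms(2)] distributed_measurable[OF assms(2)]
    by (simp_all cong: measurable_cong_sets)
  interpret M: prob_space M by fact
  interpret \<mu>: prob_space ?\<mu> by (rule M.prob_space_distr[OF X])
  have \<mu>: "?\<mu> = density lborel f"
    using distributed_distr_eq_density[OF assms(2)] distr_cong[of M M borel lborel X X] by simp
  have em: "emeasure ?\<mu> B = (\<integral>\<^sup>+x. f x * indicator B x \<partial>lborel)" if "B \<in> sets borel" for B
    unfolding \<mu> using f that by (intro emeasure_density) auto
  define A where "A m = {x. f x \<le> of_nat m}" for m :: nat
  have A: "A m \<in> sets borel" for m
    unfolding A_def using f by measurable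
  have small: "emeasure ?\<mu> (A m \<inter> ball c r) \<le> ennreal (real m * pi * r\<^sup>2)" if "r \<ge> 0" for m c r
  proof -
    have "emeasure ?\<mu> (A m \<inter> ball c r) = (\<integral>\<^sup>+x. f x * indicator (A m \<inter> ball c r) x \<partial>lborel)"
      using A by (intro em) auto
    also have "\<dots> \<le> (\<integral>\<^sup>+x. of_nat m * indicator (ball c r) x \<partial>lborel)"
      by (intro nn_integral_mono) (auto simp: A_def indicator_def)
    also have "\<dots> = of_nat m * emeasure lborel (ball c r)"
      by (simp add: nn_integral_cmult_indicator)
    also have "\<dots> = ennreal (real m * pi * r\<^sup>2)"
      using that by (simp add: emeasure_ball unit_ball_vol_2 ennreal_of_nat_eq_real_of_nat ennreal_mult[symmetric] mult_ac)
    finally show ?thesis .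
  qed
  have "\<exists>m. measure ?\<mu> (A m) > 0"
  proof (rule ccontr)
    assume "\<not> ?thesis"
    then have "\<forall>m. measure ?\<mu> (A m) = 0"
      by (simp add: not_less measure_le_0_iff)
    then have null: "A m \<in> null_sets ?\<mu>" for m
      using A by (auto simp: \<mu>.emeasure_eq_measure)
    have "emeasure ?\<mu> UNIV = (\<integral>\<^sup>+x. f x \<partial>lborel)"
      using em[of UNIV] by simp
    then have "(\<integral>\<^sup>+x. f x \<partial>lborel) \<noteq> \<infinity>"
      using \<mu>.emeasure_space_1 by simp
    then have "AE x in lborel. f x \<noteq> \<infinity>"
      using f by (intro nn_integral_PInf_AE) auto
    then have "AE x in ?\<mu>. f x \<noteq> \<infinity>"
      unfolding \<mu> using f by (subst AE_density) auto
    moreover have "AE x in ?\<mu>. \<forall>m. x \<notin> A m"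
      using null by (subst AE_all_countable) (auto intro: AE_not_in)
    ultimately have "AE x in ?\<mu>. False"
    proof eventually_elim
      case (elim x)
      then obtain m :: nat where "f x < of_nat m"
        using ennreal_Ex_less_of_nat[of "f x"] by (auto simp: less_top)
      with elim show False by (auto simp: A_def dest: less_imp_le)
    qed
    then show False by simp
  qed
  then obtain m where "measure ?\<mu> (A m) > 0" by blast
  then show ?thesis
    using A small by (intro that[of "A m" "real m * pi"]) auto
qed

text \<open>
  Induction on the number of terms, splitting off the term of lowest index \<open>k\<close> in each step.
  If that coefficient falls into \<open>A\<close>, the small ball has probability at most
  \<open>D * \<epsilon>\<^sup>2 / norm w ^ (2 * k)\<close>; the complementary case has probability
  \<open>1 - measure \<mu> A \<le> \<theta> * (norm w)\<^sup>2\<close> and leaves the sum from \<open>k + 1\<close>. The contributions add up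
  to a geometric series with ratio \<open>\<theta>\<close>, whence the factor \<open>1 / (1 - \<theta>)\<close>.
  Starting from the lowest index is essential: for \<open>norm w < 1\<close> the weights \<open>1 / norm w ^ (2 * k)\<close> grow, and the
  probability of getting as far as index \<open>k\<close> has to outweigh them. The translation \<open>c\<close> makes
  room for the part of the sum that has been split off.
\<close>

lemma (in prob_space) random_sum_small_ball:
  fixes C :: "nat \<Rightarrow> 'a \<Rightarrow> complex"
  assumes indep: "indep_vars (\<lambda>_. borel) C UNIV"
    and ident: "\<And>k. distr M borel (C k) = \<mu>"
    and A: "A \<in> sets borel" and D: "D \<ge> 0"
    and dens: "\<And>c r. r \<ge> 0 \<Longrightarrow> emeasure \<mu> (A \<inter> ball c r) \<le> ennreal (D * r\<^sup>2)"
    and \<epsilon>: "\<epsilon> \<ge> 0" and w: "w \<noteq> 0" and \<theta>: "1 - measure \<mu> A \<le> \<theta> * (norm w)\<^sup>2" "\<theta> < 1"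
  shows "emeasure M {\<omega>\<in>space M. norm ((\<Sum>j\<in>{k..<k+m}. C j \<omega> * w ^ j) + c) < \<epsilon>}
      \<le> ennreal ((1 - measure \<mu> A) ^ m + D * \<epsilon>\<^sup>2 / ((1 - \<theta>) * (norm w) ^ (2 * k)))"
proof (induction m arbitrary: k c)
  case 0
  have "emeasure M {\<omega>\<in>space M. norm ((\<Sum>j\<in>{k..<k+0}. C j \<omega> * w ^ j) + c) < \<epsilon>} \<le> ennreal 1"
    using emeasure_le_1 by simp
  also have "\<dots> \<le> ennreal ((1 - measure \<mu> A) ^ 0 + D * \<epsilon>\<^sup>2 / ((1 - \<theta>) * (norm w) ^ (2 * k)))"
    using \<theta> D by (intro ennreal_leI) simp
  finally show ?case .
next
  case (Suc m)
  let ?r = "1 - measure \<mu> A"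
  let ?S = "\<lambda>\<omega>. \<Sum>j\<in>{Suc k..<Suc k+m}. C j \<omega> * w ^ j"
  let ?\<nu> = "distr M borel ?S"
  let ?T = "D * \<epsilon>\<^sup>2 / ((1 - \<theta>) * (norm w) ^ (2 * Suc k))"
  have ind: "indep_var borel (C k) borel ?S"
    using indep by (intro indep_var_power_sum) auto
  have Ck: "C k \<in> M \<rightarrow>\<^sub>M borel" and S: "?S \<in> M \<rightarrow>\<^sub>M borel"
    using indep_var_rv1[OF ind] indep_var_rv2[OF ind] by auto
  have \<mu>: "prob_space \<mu>" "sets \<mu> = sets borel"
    using prob_space_distr[OF Ck] ident[of k, symmetric] by auto
  interpret \<mu>: prob_space \<mu> by fact
  have r: "emeasure \<mu> (- A) = ennreal ?r" "?r \<ge> 0"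
    using \<mu>.prob_compl[of A] A \<mu>(2) sets_eq_imp_space_eq[OF \<mu>(2)]
    by (simp_all add: \<mu>.emeasure_eq_measure Compl_eq_Diff_UNIV)
  have T0: "?T \<ge> 0" using D \<theta> by simp
  have step: "emeasure (\<mu> \<Otimes>\<^sub>M ?\<nu>) {z. norm (w ^ k * fst z + snd z + c) < \<epsilon>}
     \<le> ennreal (D * (\<epsilon> / norm w ^ k)\<^sup>2) + emeasure \<mu> (- A) * ennreal (?r ^ m + ?T)"
  proof (rule emeasure_pair_small_ball)
    show "emeasure \<mu> (A \<inter> {x. norm (w ^ k * x + c) < \<epsilon>}) \<le> ennreal (D * (\<epsilon> / norm w ^ k)\<^sup>2)" for c
    proof -
      have "{x. norm (w ^ k * x + c) < \<epsilon>} = ball (- c / w ^ k) (\<epsilon> / norm w ^ k)"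
      proof -
        have "norm (w ^ k * x + c) < \<epsilon> \<longleftrightarrow> dist (- c / w ^ k) x < \<epsilon> / norm w ^ k" for x
        proof -
          have "w ^ k * x + c = - (w ^ k) * (- c / w ^ k - x)" using w by (simp add: field_simps)
          then have "norm (w ^ k * x + c) = norm w ^ k * dist (- c / w ^ k) x"
            by (simp only: dist_norm norm_mult norm_minus_cancel norm_power)
          then show ?thesis using w by (simp add: field_simps)
        qed
        then show ?thesis by (intro set_eqI) (simp only: mem_Collect_eq mem_ball)
      qed
      then show ?thesis using dens[of "\<epsilon> / norm w ^ k" "- c / w ^ k"] \<epsilon> by simp
    qed
    show "emeasure ?\<nu> {y. norm (y + c) < \<epsilon>} \<le> ennreal (?r ^ m + ?T)" for c
    proof -
      have "{y. norm (y + c) < \<epsilon>} \<in> sets borel"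
        by (intro borel_open open_Collect_less continuous_intros)
      then have "emeasure ?\<nu> {y. norm (y + c) < \<epsilon>} = emeasure M {\<omega>\<in>space M. norm (?S \<omega> + c) < \<epsilon>}"
        using S by (subst emeasure_distr) (auto intro!: arg_cong[where f = "emeasure M"])
      also have "\<dots> \<le> ennreal (?r ^ m + ?T)" by (rule Suc.IH)
      finally show ?thesis .
    qed
  qed (use \<mu> A prob_space_distr[OF S] in auto)
  have sum: "(\<Sum>j\<in>{k..<k+Suc m}. C j \<omega> * w ^ j) = w ^ k * C k \<omega> + ?S \<omega>" for \<omega>
    by (simp add: sum.atLeast_Suc_lessThan mult.commute)
  have H: "{z. norm (w ^ k * fst z + snd z + c) < \<epsilon>} \<in> sets (borel \<Otimes>\<^sub>M borel)"
    unfolding borel_prod by (intro borel_open open_Collect_less continuous_intros)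
  have pair: "\<mu> \<Otimes>\<^sub>M ?\<nu> = distr M (borel \<Otimes>\<^sub>M borel) (\<lambda>\<omega>. (C k \<omega>, ?S \<omega>))"
    using ind ident[of k] unfolding indep_var_distribution_eq by simp
  have "emeasure M {\<omega>\<in>space M. norm ((\<Sum>j\<in>{k..<k+Suc m}. C j \<omega> * w ^ j) + c) < \<epsilon>}
      = emeasure (\<mu> \<Otimes>\<^sub>M ?\<nu>) {z. norm (w ^ k * fst z + snd z + c) < \<epsilon>}"
    unfolding pair sum using H Ck S
    by (subst emeasure_distr) (auto intro!: arg_cong[where f = "emeasure M"])
  also note step
  also have "ennreal (D * (\<epsilon> / norm w ^ k)\<^sup>2) + emeasure \<mu> (- A) * ennreal (?r ^ m + ?T)
      = ennreal (D * (\<epsilon> / norm w ^ k)\<^sup>2 + ?r * (?r ^ m + ?T))"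
    using r D T0 by (simp add: ennreal_mult[symmetric] ennreal_plus[symmetric] del: ennreal_plus)
  also have "\<dots> \<le> ennreal (?r ^ Suc m + D * \<epsilon>\<^sup>2 / ((1 - \<theta>) * (norm w) ^ (2 * k)))"
  proof (intro ennreal_leI)
    have "?r * ?T \<le> (\<theta> * (norm w)\<^sup>2) * ?T" using \<theta> T0 by (intro mult_right_mono) auto
    also have "\<dots> = \<theta> / (1 - \<theta>) * (D * \<epsilon>\<^sup>2 / norm w ^ (2 * k))"
      using w by (simp add: power2_eq_square)
    finally have le: "?r * ?T \<le> \<theta> / (1 - \<theta>) * (D * \<epsilon>\<^sup>2 / norm w ^ (2 * k))" .
    have e: "D * (\<epsilon> / norm w ^ k)\<^sup>2 = D * \<epsilon>\<^sup>2 / norm w ^ (2 * k)"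
      by (simp add: power_divide power_mult[symmetric] mult.commute)
    from le have "D * (\<epsilon> / norm w ^ k)\<^sup>2 + ?r * ?T
        \<le> (1 + \<theta> / (1 - \<theta>)) * (D * \<epsilon>\<^sup>2 / norm w ^ (2 * k))"
      unfolding e distrib_right by simp
    also have "1 + \<theta> / (1 - \<theta>) = 1 / (1 - \<theta>)" using \<theta> by (simp add: field_simps)
    finally show "D * (\<epsilon> / norm w ^ k)\<^sup>2 + ?r * (?r ^ m + ?T)
        \<le> ?r ^ Suc m + D * \<epsilon>\<^sup>2 / ((1 - \<theta>) * (norm w) ^ (2 * k))"
      by (simp add: distrib_left)
  qed
  finally show ?case .
qed

section \<open>The expected number of zeros\<close>

lemma scaled_zero_measure:
  assumes "n > 0"
  shows "real n * zero_measure n p E = real (size (filter_mset (\<lambda>z. z \<in> E) (proots p)))"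
proof -
  have "(\<Sum>z\<in>#A. indicator E z :: real) = real (size (filter_mset (\<lambda>z. z \<in> E) A))" for A
    by (induction A) auto
  then show ?thesis using assms by (simp add: zero_measure_def)
qed

lemma degree_random_poly: "degree (random_poly C n \<omega>) \<le> n"
  unfolding random_poly_def
  by (intro degree_sum_le) (auto intro: order_trans[OF degree_monom_le])

lemma coeff_random_poly: "coeff (random_poly C n \<omega>) k = (if k \<le> n then C k \<omega> else 0)"
  unfolding random_poly_def by (simp add: coeff_sum)

lemma poly_random_poly: "poly (random_poly C n \<omega>) z = (\<Sum>k\<le>n. C k \<omega> * z ^ k)"
  unfolding random_poly_def by (simp add: poly_sum poly_monom)

lemma mult_geometric_bounded:
  fixes a :: real
  assumes "0 < a" "a \<le> 1"
  shows "real n * (1 - a) ^ n \<le> 1 / a"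
proof -
  have "(1 + real n * a) * (1 - a) ^ n \<le> (1 + a) ^ n * (1 - a) ^ n"
    using Bernoulli_inequality[of a n] assms by (intro mult_right_mono) auto
  also have "\<dots> = (1 - a\<^sup>2) ^ n"
    by (simp add: power_mult_distrib[symmetric] power2_eq_square algebra_simps)
  also have "\<dots> \<le> 1"
    using assms by (intro power_le_one) (auto simp: power_le_one)
  finally have "real n * a * (1 - a) ^ n \<le> 1"
    using assms by (simp add: distrib_right) (smt (verit) zero_le_power)
  then show ?thesis using assms by (simp add: field_simps)
qed

text \<open>
  With \<open>a\<close> the probability that a coefficient falls into the set of bounded density, every \<open>z\<close>
  with \<open>1 - a / 2 \<le> (norm z)\<^sup>2\<close> is admissible for \<open>random_sum_small_ball\<close> with the common ratio
  \<open>\<theta> = (1 - a) / (1 - a / 2) < 1\<close>. This covers the unit circle and some points of the open disc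
  at once. Of the two terms of the bound, \<open>(1 - a) ^ (n + 1)\<close> decays exponentially and the
  other is a multiple of \<open>1 / n\<^sup>2\<close>.
\<close>

lemma (in prob_space) random_poly_small_value:
  fixes C :: "nat \<Rightarrow> 'a \<Rightarrow> complex"
  assumes indep: "indep_vars (\<lambda>_. borel) C UNIV"
    and ident: "\<And>k. distr M borel (C k) = distr M borel (C 0)"
    and dens: "distributed M lborel (C 0) f"
  obtains \<rho> c where "0 < \<rho>" "\<rho> < 1" "c \<ge> 0"
    "\<And>z n. n > 0 \<Longrightarrow> norm z \<ge> \<rho> \<Longrightarrow>
       real n * prob {\<omega>\<in>space M. norm (poly (random_poly C n \<omega>) z) < 1 / real n} \<le> c"
proof -
  let ?\<mu> = "distr M borel (C 0)"
  obtain A D where A: "A \<in> sets borel" "measure ?\<mu> A > 0" and D: "D \<ge> 0"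
    and small: "\<And>c r. r \<ge> 0 \<Longrightarrow> emeasure ?\<mu> (A \<inter> ball c r) \<le> ennreal (D * r\<^sup>2)"
    using bounded_density_part[OF prob_space_axioms dens] by blast
  define a where "a = measure ?\<mu> A"
  have "C 0 \<in> M \<rightarrow>\<^sub>M borel" using indep by (auto simp: indep_vars_def)
  then interpret \<mu>: prob_space ?\<mu> by (rule prob_space_distr)
  have a: "0 < a" "a \<le> 1" using A by (auto simp: a_def)
  define \<theta> where "\<theta> = (1 - a) / (1 - a / 2)"
  have \<theta>: "\<theta> < 1" "\<theta> \<ge> 0" using a by (auto simp: \<theta>_def divide_simps)
  define \<rho> where "\<rho> = sqrt (1 - a / 2)"
  have \<rho>: "0 < \<rho>" "\<rho> < 1" "\<rho>\<^sup>2 = 1 - a / 2" using a by (auto simp: \<rho>_def)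
  show ?thesis
  proof (rule that[of \<rho> "1 / a + D / (1 - \<theta>)"])
    show "1 / a + D / (1 - \<theta>) \<ge> 0" using a D \<theta> by simp
    fix z :: complex and n :: nat
    assume n: "n > 0" and z: "norm z \<ge> \<rho>"
    have "(norm z)\<^sup>2 \<ge> 1 - a / 2" using power_mono[OF z, of 2] \<rho> by simp
    then have "\<theta> * (norm z)\<^sup>2 \<ge> \<theta> * (1 - a / 2)" using \<theta> by (intro mult_left_mono) auto
    also have "\<theta> * (1 - a / 2) = 1 - a" using a by (simp add: \<theta>_def)
    finally have \<theta>z: "1 - measure ?\<mu> A \<le> \<theta> * (norm z)\<^sup>2" by (simp add: a_def)
    have eq: "norm (poly (random_poly C n \<omega>) z) = norm ((\<Sum>j\<in>{0..<0 + Suc n}. C j \<omega> * z ^ j) + 0)" for \<omega>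
      by (simp only: poly_random_poly add_0 add_0_right atLeast0LessThan lessThan_Suc_atMost)
    have "z \<noteq> 0" using z \<rho> by auto
    have "emeasure M {\<omega>\<in>space M. norm (poly (random_poly C n \<omega>) z) < 1 / real n}
        \<le> ennreal ((1 - a) ^ Suc n + D * (1 / real n)\<^sup>2 / ((1 - \<theta>) * norm z ^ (2 * 0)))"
      unfolding eq a_def
      using A(1) D n \<open>z \<noteq> 0\<close> \<theta>z \<theta>(1)
      by (intro random_sum_small_ball[OF indep ident] small) auto
    then have "prob {\<omega>\<in>space M. norm (poly (random_poly C n \<omega>) z) < 1 / real n}
        \<le> (1 - a) ^ Suc n + D * (1 / real n)\<^sup>2 / (1 - \<theta>)"
      using a D \<theta> by (simp add: emeasure_eq_measure del: power_Suc ennreal_plus)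
    then have "real n * prob {\<omega>\<in>space M. norm (poly (random_poly C n \<omega>) z) < 1 / real n}
        \<le> real n * ((1 - a) ^ Suc n + D * (1 / real n)\<^sup>2 / (1 - \<theta>))"
      by (intro mult_left_mono) auto
    also have "\<dots> = real n * (1 - a) ^ Suc n + D / (1 - \<theta>) * (1 / real n)"
      using n by (simp add: distrib_left power2_eq_square del: power_Suc)
    also have "\<dots> \<le> 1 / a + D / (1 - \<theta>)"
    proof (intro add_mono)
      have "real n * (1 - a) ^ Suc n \<le> real n * (1 - a) ^ n"
        using a by (intro mult_left_mono power_decreasing) auto
      then show "real n * (1 - a) ^ Suc n \<le> 1 / a" using mult_geometric_bounded[OF a, of n] by linarith
      show "D / (1 - \<theta>) * (1 / real n) \<le> D / (1 - \<theta>)"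
        using D \<theta> n by (intro mult_left_le) auto
    qed
    finally show "real n * prob {\<omega>\<in>space M. norm (poly (random_poly C n \<omega>) z) < 1 / real n}
        \<le> 1 / a + D / (1 - \<theta>)" .
  qed (use \<rho> in auto)
qed

lemma (in prob_space) moment_tail:
  fixes X Y :: "'a \<Rightarrow> 'b::{real_normed_vector, second_countable_topology}"
  assumes X: "X \<in> M \<rightarrow>\<^sub>M borel" and Y: "Y \<in> M \<rightarrow>\<^sub>M borel"
    and ident: "distr M borel Y = distr M borel X"
    and t: "t > 0" and int: "integrable M (\<lambda>\<omega>. norm (X \<omega>) powr t)" and H: "H > 0"
  shows "prob {\<omega>\<in>space M. norm (Y \<omega>) > H} \<le> expectation (\<lambda>\<omega>. norm (X \<omega>) powr t) / H powr t"
proof -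
  have S: "{x. norm x > H} \<in> sets (borel :: 'b measure)"
    by (intro borel_open open_Collect_less continuous_intros)
  have "prob {\<omega>\<in>space M. norm (Y \<omega>) > H} = measure (distr M borel Y) {x. norm x > H}"
    using Y S by (subst measure_distr) (auto intro!: arg_cong[where f = prob])
  also have "\<dots> = prob {\<omega>\<in>space M. norm (X \<omega>) > H}"
    unfolding ident using X S by (subst measure_distr) (auto intro!: arg_cong[where f = prob])
  also have "\<dots> \<le> prob {\<omega>\<in>space M. norm (X \<omega>) powr t \<ge> H powr t}"
    using X t H by (intro finite_measure_mono) (auto intro!: powr_mono2)
  also have "\<dots> \<le> expectation (\<lambda>\<omega>. norm (X \<omega>) powr t) / H powr t"
    using H by (intro integral_Markov_inequality_measure[OF int, of "{}"]) auto
  finally show ?thesis .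
qed

text \<open>
  The bound of \<open>zeros_in_nontangential_set\<close> at the scale \<open>s\<close> at which its two parts have the same
  order: \<open>s * n\<close> and \<open>ln n / s\<close> are both equal to \<open>sqrt (n * ln n)\<close>.
\<close>

lemma log_scale_bound:
  fixes \<kappa> K b :: real
  assumes n: "n \<ge> 3" and \<kappa>: "\<kappa> \<ge> 0" and K: "K > 0" and b: "b > 0"
    and s_def: "s = sqrt (ln (real n) / real n)"
  shows "8 / (b * s) * ln (real (n + 1) * real n powr \<kappa> / (1 / real n))
      + real m / ln 2 * (2 * K * s * real n + ln (real (n + 1) * real n powr \<kappa> / (1 / real n)))
    \<le> (8 / b * (\<kappa> + 3) + real m / ln 2 * (2 * K + (\<kappa> + 3))) * sqrt (real n * ln (real n))"
proof -
  let ?L = "ln (real n)" and ?Q = "sqrt (real n * ln (real n))"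
  let ?l = "ln (real (n + 1) * real n powr \<kappa> / (1 / real n))"
  have L: "?L > 0" "?L \<le> real n" using n ln_le_minus_one[of "real n"] by auto
  have "?l = ln (real (n + 1)) + \<kappa> * ?L + ?L"
    using n by (simp add: ln_mult ln_powr)
  also have "ln (real (n + 1)) \<le> ln (real n ^ 2)"
  proof -
    have "3 * real n \<le> real n ^ 2" using n by (simp add: power2_eq_square)
    then show ?thesis using n by (subst ln_le_cancel_iff) auto
  qed
  also have "ln (real n ^ 2) = 2 * ?L" using n by (simp add: ln_realpow)
  finally have l: "?l \<le> (\<kappa> + 3) * ?L" by (simp add: algebra_simps)
  have s: "s > 0" using L n by (simp add: s_def)
  have sn: "s * real n = ?Q"
  proof -
    have "s * real n = sqrt (?L / real n) * sqrt (real n * real n)" using n by (simp add: s_def)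
    also have "\<dots> = ?Q" unfolding real_sqrt_mult[symmetric] using n by (simp add: mult.commute)
    finally show ?thesis .
  qed
  have sQ: "?Q * s = ?L"
  proof -
    have "?Q * s = sqrt (?L * ?L)" unfolding s_def real_sqrt_mult[symmetric] using n by simp
    then show ?thesis using L by simp
  qed
  then have Ls: "?L / s = ?Q" using s by (simp add: field_simps)
  have LQ: "?L \<le> ?Q"
    using L by (intro real_le_rsqrt) (simp add: power2_eq_square)
  have "8 / (b * s) * ?l \<le> 8 / (b * s) * ((\<kappa> + 3) * ?L)"
    using l b s by (intro mult_left_mono) auto
  also have "\<dots> = 8 / b * (\<kappa> + 3) * (?L / s)" by simp
  finally have 1: "8 / (b * s) * ?l \<le> 8 / b * (\<kappa> + 3) * ?Q" unfolding Ls .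
  have "?l \<le> (\<kappa> + 3) * ?Q"
    using l mult_left_mono[OF LQ, of "\<kappa> + 3"] \<kappa> by linarith
  then have "2 * K * s * real n + ?l \<le> (2 * K + (\<kappa> + 3)) * ?Q"
    unfolding mult.assoc sn by (simp add: algebra_simps)
  then have 2: "real m / ln 2 * (2 * K * s * real n + ?l) \<le> real m / ln 2 * ((2 * K + (\<kappa> + 3)) * ?Q)"
    by (intro mult_left_mono) auto
  from add_mono[OF 1 2] show ?thesis by (simp only: distrib_right mult.assoc)
qed

text \<open>
  The Bochner integral of a non-integrable function is \<open>0\<close>, so pointwise bounds suffice and the
  estimate applies to the number of zeros directly, in advance of any question of its measurability.
\<close>

lemma (in prob_space) expectation_le_off_bad_event:
  fixes f :: "'a \<Rightarrow> real"
  assumes "B \<in> events" "\<And>\<omega>. \<omega> \<in> space M \<Longrightarrow> 0 \<le> f \<omega>" "\<And>\<omega>. \<omega> \<in> space M \<Longrightarrow> f \<omega> \<le> N"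
    and "\<And>\<omega>. \<omega> \<in> space M \<Longrightarrow> \<omega> \<notin> B \<Longrightarrow> f \<omega> \<le> c" and "0 \<le> c" "0 \<le> N"
  shows "\<bar>expectation f\<bar> \<le> N * prob B + c"
proof (cases "integrable M f")
  case True
  have int: "integrable M (\<lambda>\<omega>. N * indicator B \<omega>)"
    using assms(1) by (intro integrable_mult_right integrable_real_indicator) (auto simp: emeasure_eq_measure)
  then have "integrable M (\<lambda>\<omega>. N * indicator B \<omega> + c)"
    by simp
  then have "expectation f \<le> (\<integral>\<omega>. N * indicator B \<omega> + c \<partial>M)"
  proof (intro integral_mono True)
    show "f \<omega> \<le> N * indicator B \<omega> + c" if "\<omega> \<in> space M" for \<omega>
      using assms(3,4)[OF that] assms(5) by (cases "\<omega> \<in> B") auto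
  qed (use assms in auto)
  also have "\<dots> = N * prob B + c" using assms(1) int by (simp add: prob_space)
  finally show ?thesis using Bochner_Integration.integral_nonneg[of M f] assms(2) by simp
next
  case False
  then show ?thesis using assms by (simp add: not_integrable_integral_eq)
qed

theorem proposition3p5:
  fixes M :: "'a measure" and C :: "nat \<Rightarrow> 'a \<Rightarrow> complex"
    and t :: real and E :: "complex set"
  assumes "prob_space M"
    and "prob_space.indep_vars M (\<lambda>_. borel) C UNIV"
    and "\<And>k. distr M borel (C k) = distr M borel (C 0)"
    and "\<exists>f. distributed M lborel (C 0) f"
    and "t > 0"
    and "integrable M (\<lambda>\<omega>. norm (C 0 \<omega>) powr t)"
    and "inscribed_polygon E"
  shows "(\<lambda>n. \<integral>\<omega>. real n * zero_measure n (random_poly C n \<omega>) E \<partial>M)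
           \<in> O(\<lambda>n. sqrt (real n * ln (real n)))"
proof -
  interpret prob_space M by fact
  note indep = assms(2) and ident = assms(3) and t = assms(5) and moment = assms(6)
  have meas [measurable]: "C k \<in> M \<rightarrow>\<^sub>M borel" for k
    using indep by (auto simp: indep_vars_def)
  obtain V where V: "finite V" "V \<subseteq> sphere 0 1" and EV: "E \<subseteq> convex hull V"
    using inscribed_polygon_subset_hull[OF assms(7)] by blast
  obtain K where K: "K > 0" and hull: "\<And>z. z \<in> convex hull V \<Longrightarrow> \<exists>v\<in>V. dist z v \<le> K * (1 - norm z)"
    using hull_nontangential[OF V] by blast
  obtain f where f: "distributed M lborel (C 0) f" using assms(4) by blast
  obtain \<rho> c where \<rho>: "0 < \<rho>" "\<rho> < 1" and c: "c \<ge> 0"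
    and small: "\<And>z n. n > 0 \<Longrightarrow> norm z \<ge> \<rho> \<Longrightarrow>
       real n * prob {\<omega>\<in>space M. norm (poly (random_poly C n \<omega>) z) < 1 / real n} \<le> c"
    using random_poly_small_value[OF indep ident f] by blast
  define w where "w = complex_of_real \<rho>"
  have w: "norm w = \<rho>" using \<rho> by (simp add: w_def)
  define W where "W = insert w V"
  have W: "finite W" "\<And>z. z \<in> W \<Longrightarrow> norm z \<ge> \<rho>"
    using V \<rho> w by (auto simp: W_def)
  \<comment> \<open>The exponent for which Markov's inequality bounds \<open>prob {\<omega>\<in>space M. norm (C k \<omega>) > n powr \<kappa>}\<close>
    by \<open>\<mu> / n\<^sup>2\<close>; summed over all coefficients this is still \<open>O(1 / n)\<close>.\<close>
  define \<kappa> where "\<kappa> = 2 / t"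
  define \<mu> where "\<mu> = expectation (\<lambda>\<omega>. norm (C 0 \<omega>) powr t)"
  have \<mu>: "\<mu> \<ge> 0" unfolding \<mu>_def by (intro Bochner_Integration.integral_nonneg) auto
  define b where "b = 1 - \<rho>\<^sup>2"
  have b: "b > 0" using \<rho> by (simp add: b_def power_less_one_iff)
  define c1 where "c1 = card W * c + 2 * \<mu>"
  define c2 where "c2 = 8 / b * (\<kappa> + 3) + real (card V) / ln 2 * (2 * K + (\<kappa> + 3))"
  have \<kappa>: "\<kappa> \<ge> 0" using t by (simp add: \<kappa>_def)
  have c12: "c1 \<ge> 0" "c2 \<ge> 0" using c \<mu> b \<kappa> K by (auto simp: c1_def c2_def)
  have bound: "\<bar>\<integral>\<omega>. real n * zero_measure n (random_poly C n \<omega>) E \<partial>M\<bar> \<le> (c1 + c2) * sqrt (real n * ln (real n))"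
    if n: "n \<ge> 3" for n
  proof -
    let ?Q = "sqrt (real n * ln (real n))"
    define Small where "Small z = {\<omega>\<in>space M. norm (poly (random_poly C n \<omega>) z) < 1 / real n}" for z
    define Large where "Large k = {\<omega>\<in>space M. norm (C k \<omega>) > real n powr \<kappa>}" for k
    define Bad where "Bad = (\<Union>z\<in>W. Small z) \<union> (\<Union>k\<le>n. Large k)"
    have Small: "Small z \<in> events" for z
      unfolding Small_def poly_random_poly by measurable
    have Large: "Large k \<in> events" for k
      unfolding Large_def by measurable
    have Bad: "Bad \<in> events" unfolding Bad_def using Small Large W by (intro sets.Un sets.finite_UN) auto
    have ln: "ln (real n) \<ge> 1"
    proof -
      have "exp 1 \<le> (3::real)" using exp_le by simp
      then show ?thesis using n by (subst ln_ge_iff) auto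
    qed
    have "real n * prob Bad \<le> real n * ((\<Sum>z\<in>W. prob (Small z)) + (\<Sum>k\<le>n. prob (Large k)))"
    proof (intro mult_left_mono)
      have "prob Bad \<le> prob (\<Union>z\<in>W. Small z) + prob (\<Union>k\<le>n. Large k)"
        unfolding Bad_def using Small Large W by (intro measure_Un_le) auto
      also have "\<dots> \<le> (\<Sum>z\<in>W. prob (Small z)) + (\<Sum>k\<le>n. prob (Large k))"
        using Small Large W by (intro add_mono measure_UNION_le) auto
      finally show "prob Bad \<le> (\<Sum>z\<in>W. prob (Small z)) + (\<Sum>k\<le>n. prob (Large k))" .
    qed simp
    also have "\<dots> = (\<Sum>z\<in>W. real n * prob (Small z)) + real n * (\<Sum>k\<le>n. prob (Large k))"
      by (simp add: distrib_left sum_distrib_left)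
    also have "\<dots> \<le> card W * c + 2 * \<mu>"
    proof (intro add_mono)
      show "(\<Sum>z\<in>W. real n * prob (Small z)) \<le> card W * c"
        using small[of n] W n unfolding Small_def by (intro sum_bounded_above) auto
      have "prob (Large k) \<le> \<mu> / (real n)\<^sup>2" for k
      proof -
        have "(real n powr \<kappa>) powr t = (real n)\<^sup>2" using t n by (simp add: powr_powr \<kappa>_def)
        then show ?thesis
          using moment_tail[OF meas meas ident t moment, of "real n powr \<kappa>" k] n
          by (simp add: Large_def \<mu>_def)
      qed
      then have "(\<Sum>k\<le>n. prob (Large k)) \<le> real (card {..n}) * (\<mu> / (real n)\<^sup>2)"
        by (intro sum_bounded_above)
      then have "real n * (\<Sum>k\<le>n. prob (Large k)) \<le> real n * (real (n + 1) * (\<mu> / (real n)\<^sup>2))"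
        by (intro mult_left_mono) auto
      also have "\<dots> = (real (n + 1) / real n) * \<mu>"
        using n by (simp add: power2_eq_square)
      also have "\<dots> \<le> 2 * \<mu>" using n \<mu> by (intro mult_right_mono) (auto simp: field_simps)
      finally show "real n * (\<Sum>k\<le>n. prob (Large k)) \<le> 2 * \<mu>" .
    qed
    finally have PBad: "real n * prob Bad \<le> c1" by (simp add: c1_def)
    have "\<bar>\<integral>\<omega>. real n * zero_measure n (random_poly C n \<omega>) E \<partial>M\<bar> \<le> real n * prob Bad + c2 * ?Q"
    proof (intro expectation_le_off_bad_event Bad)
      fix \<omega> assume \<omega>: "\<omega> \<in> space M"
      let ?p = "random_poly C n \<omega>"
      have N: "real n * zero_measure n ?p E = real (size (filter_mset (\<lambda>z. z \<in> E) (proots ?p)))"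
        using n by (intro scaled_zero_measure) auto
      show "real n * zero_measure n ?p E \<ge> 0" unfolding N by simp
      have "size (filter_mset (\<lambda>z. z \<in> E) (proots ?p)) \<le> size (proots ?p)"
        by (rule size_filter_mset_lesseq)
      also have "\<dots> \<le> n" using degree_random_poly[of C n \<omega>] by (simp add: size_proots_complex)
      finally show "real n * zero_measure n ?p E \<le> real n" unfolding N by simp
      assume good: "\<omega> \<notin> Bad"
      define s where "s = sqrt (ln (real n) / real n)"
      have "real (size (filter_mset (\<lambda>z. z \<in> E) (proots ?p)))
        \<le> 8 / ((1 - (norm w)\<^sup>2) * s) * ln (real (n + 1) * real n powr \<kappa> / (1 / real n))
          + real (card V) / ln 2 * (2 * K * s * real n + ln (real (n + 1) * real n powr \<kappa> / (1 / real n)))"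
      proof (rule zeros_in_nontangential_set[OF degree_random_poly _ V K])
        show "norm (coeff ?p k) \<le> real n powr \<kappa>" if "k \<le> n" for k
          using good \<omega> that by (auto simp: coeff_random_poly Bad_def Large_def not_less)
        show "norm (poly ?p w) \<ge> 1 / real n"
          using good \<omega> by (auto simp: Bad_def Small_def W_def not_less)
        show "norm (poly ?p v) \<ge> 1 / real n" if "v \<in> V" for v
          using good \<omega> that by (auto simp: Bad_def Small_def W_def not_less)
        show "0 < s" using ln n by (simp add: s_def)
        show "s \<le> 1" using n ln_le_minus_one[of "real n"] by (simp add: s_def)
      qed (use hull EV w \<rho> n in auto)
      also have "\<dots> \<le> c2 * ?Q"
        using log_scale_bound[OF n \<kappa> K b s_def, of "card V"] w by (simp add: b_def c2_def)
      finally show "real n * zero_measure n ?p E \<le> c2 * ?Q" unfolding N .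
    qed (use c12 ln in auto)
    also have "\<dots> \<le> c1 * ?Q + c2 * ?Q"
    proof -
      have "1 \<le> real n * ln (real n)" using mult_mono[of 1 "real n" 1 "ln (real n)"] n ln by simp
      then have "c1 * 1 \<le> c1 * ?Q" using c12 by (intro mult_left_mono) auto
      then show ?thesis using PBad by simp
    qed
    finally show ?thesis by (simp add: distrib_right)
  qed
  show ?thesis
  proof (rule bigoI[of _ "c1 + c2"])
    show "\<forall>\<^sub>F n in sequentially. norm (\<integral>\<omega>. real n * zero_measure n (random_poly C n \<omega>) E \<partial>M)
        \<le> (c1 + c2) * norm (sqrt (real n * ln (real n)))"
      using eventually_ge_at_top[of 3]
    proof eventually_elim
      case (elim n)
      then have "sqrt (real n * ln (real n)) \<ge> 0" by auto
      then show ?case using bound[OF elim] by simp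
    qed
  qed
qed

end
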